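(* Let $(X,\mathcal{C})$ be a connectivity space with at least $3$ points. Then $(X,\mathcal{C})$ is $2$-flimsy if and only if it is $\mathrm{T}_1$ and its collection $\mathcal{C}$ of $\mathcal{C}$-connected subsets is closed under complement (i.e., $A\in\mathcal{C}$ implies $X\setminus A\in\mathcal{C}$).
   Context: A connectivity space is a pair $(X,\mathcal{C})$ where $X$ is a set and $\mathcal{C}$ is a set of subsets of $X$ (called the $\mathcal{C}$-connected subsets) such that: (C1) for any $x\in X$, $\{x\}\in\mathcal{C}$; (C2) for any $C\subseteq\mathcal{C}$, if $\bigcap C\neq\varnothing$ then $\bigcup C\in\mathcal{C}$ (in particular, by convention, $\varnothing\in\mathcal{C}$); (C3) for any $Y\in\mathcal{C}$ and any $x,y\in Y$, the subset $C:=\bigcup\{Z\in\mathcal{C} : y\in Z \text{ and } Z\subseteq Y\setminus\{x\}\}$ satisfies $Y\setminus C\in\mathcal{C}$; (C4) for any non-empty $A,B\in\mathcal{C}$ such that $A\cup B\in\mathcal{C}$, at least one of the following holds: (i) there exists $x\in A\cup B$ such that $A\cup\{x\}\in\mathcal{C}$ and $B\cup\{x\}\in\mathcal{C}$; or (ii) there exists $S\in\mathcal{C}$ with $S\subseteq A\cup B$ such that $S\cap A\notin\mathcal{C}$ or $S\cap B\notin\mathcal{C}$. A connectivity space $(X,\mathcal{C})$ is $\mathrm{T}_1$ when $\{x,y\}\notin\mathcal{C}$ for any distinct $x,y\in X$. It is $2$-flimsy if $|X|>2$ and if, for any $S\subseteq X$, $X\setminus S\in\mathcal{C}$ whenever $|S|<2$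 and $X\setminus S\notin\mathcal{C}$ whenever $|S|=2$. *)

theory Defs
  imports Main
begin

(* In C2 the family F may be empty. Since \<Inter>{} = UNIV is non-empty, this instance is
   the convention that the empty set is connected (also when X is empty). *)
locale connectivity_space =
  fixes X :: "'a set" and \<C> :: "'a set set"
  assumes connected_subset: "\<C> \<subseteq> Pow X"
    and C1: "\<And>x. x \<in> X \<Longrightarrow> {x} \<in> \<C>"
    and C2: "\<And>F. F \<subseteq> \<C> \<Longrightarrow> \<Inter>F \<noteq> {} \<Longrightarrow> \<Union>F \<in> \<C>"
    and C3: "\<And>Y x y. Y \<in> \<C> \<Longrightarrow> x \<in> Y \<Longrightarrow> y \<in> Y \<Longrightarrow>
               Y - \<Union>{Z \<in> \<C>. y \<in> Z \<and> Z \<subseteq> Y - {x}} \<in> \<C>"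
    and C4: "\<And>A B. A \<in> \<C> \<Longrightarrow> B \<in> \<C> \<Longrightarrow> A \<noteq> {} \<Longrightarrow> B \<noteq> {} \<Longrightarrow> A \<union> B \<in> \<C> \<Longrightarrow>
               (\<exists>x \<in> A \<union> B. A \<union> {x} \<in> \<C> \<and> B \<union> {x} \<in> \<C>) \<or>
               (\<exists>S \<in> \<C>. S \<subseteq> A \<union> B \<and> (S \<inter> A \<notin> \<C> \<or> S \<inter> B \<notin> \<C>))"

definition T1_connectivity :: "'a set \<Rightarrow> 'a set set \<Rightarrow> bool" where
  "T1_connectivity X \<C> \<longleftrightarrow> (\<forall>x \<in> X. \<forall>y \<in> X. x \<noteq> y \<longrightarrow> {x, y} \<notin> \<C>)"

(* card is 0 on infinite sets, so cardinality bounds need an explicit finiteness case. *)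
definition two_flimsy :: "'a set \<Rightarrow> 'a set set \<Rightarrow> bool" where
  "two_flimsy X \<C> \<longleftrightarrow>
     (infinite X \<or> card X > 2) \<and>
     (\<forall>S \<subseteq> X. (finite S \<and> card S < 2 \<longrightarrow> X - S \<in> \<C>) \<and>
              (card S = 2 \<longrightarrow> X - S \<notin> \<C>))"

end

theory Submission
  imports Defs
begin

text \<open>
  If connectedness is preserved by complements and no pair of points is connected, then deleting
  at most one point from \<open>X\<close> leaves the complement of a connected set, while a connected
  complement of a pair would make that pair connected.

  Conversely, let \<open>X\<close> be 2-flimsy and \<open>A\<close> a non-empty connected set. Two points \<open>a \<noteq> b\<close> outside
  \<open>A\<close> are joined by a connected set outside \<open>A\<close>, namely the complement of the component \<open>U\<close> of
  \<open>X - {a, b}\<close> that includes \<open>A\<close>. Indeed, \<open>U\<close> is a component of what remains when \<open>b\<close> is deleted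
  from the connected set \<open>X - {a}\<close>, so \<open>X - {a} - U\<close> is connected by (C3), and likewise
  \<open>X - {b} - U\<close>. These two sets meet because \<open>X - {a, b}\<close> is not connected, and their union is
  \<open>X - U\<close>. Hence \<open>X - A\<close> is connected. In particular a connected pair of points would have a
  connected complement, contrary to 2-flimsiness, so the space is T1.
\<close>

context connectivity_space
begin

lemma empty_connected: "{} \<in> \<C>"
  using C2[of "{}"] by simp

lemma connected_Un:
  assumes "A \<in> \<C>" "B \<in> \<C>" "A \<inter> B \<noteq> {}"
  shows "A \<union> B \<in> \<C>"
  using C2[of "{A, B}"] assms by simp

lemma connected_if_pairs_joined:
  assumes joined: "\<And>a b. a \<in> B \<Longrightarrow> b \<in> B \<Longrightarrow> \<exists>Z\<in>\<C>. a \<in> Z \<and> b \<in> Z \<and> Z \<subseteq> B"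
  shows "B \<in> \<C>"
proof (cases "B = {}")
  case True
  then show ?thesis by (simp add: empty_connected)
next
  case False
  then obtain a where a: "a \<in> B" by blast
  let ?F = "{Z \<in> \<C>. a \<in> Z \<and> Z \<subseteq> B}"
  have "\<Union>?F \<in> \<C>" by (rule C2) auto
  moreover have "\<Union>?F = B" using joined[OF a] by blast
  ultimately show ?thesis by simp
qed

lemma joined_outside_connected:
  assumes Xa: "X - {a} \<in> \<C>" and Xb: "X - {b} \<in> \<C>" and Xab: "X - {a, b} \<notin> \<C>"
    and A: "A \<in> \<C>" "A \<noteq> {}" "A \<subseteq> X - {a, b}" and ab: "a \<in> X" "b \<in> X" "a \<noteq> b"
  shows "\<exists>Z\<in>\<C>. a \<in> Z \<and> b \<in> Z \<and> Z \<subseteq> X - A"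
proof -
  obtain u where u: "u \<in> A" using A(2) by blast
  define U where "U = \<Union>{Z \<in> \<C>. u \<in> Z \<and> Z \<subseteq> X - {a, b}}"
  have "U \<in> \<C>" unfolding U_def by (rule C2) auto
  have AU: "A \<subseteq> U" and UX: "U \<subseteq> X - {a, b}" using A u unfolding U_def by auto
  have "X - {a} - {b} = X - {a, b}" "X - {b} - {a} = X - {a, b}" by auto
  moreover have "b \<in> X - {a}" "u \<in> X - {a}" "a \<in> X - {b}" "u \<in> X - {b}"
    using ab u A(3) by auto
  ultimately have conn: "X - {a} - U \<in> \<C>" "X - {b} - U \<in> \<C>"
    using C3[OF Xa, of b u] C3[OF Xb, of a u] unfolding U_def by metis+
  have "U \<noteq> X - {a, b}" using \<open>U \<in> \<C>\<close> Xab by auto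
  then have "(X - {a} - U) \<inter> (X - {b} - U) \<noteq> {}" using UX by blast
  then have "(X - {a} - U) \<union> (X - {b} - U) \<in> \<C>" by (rule connected_Un[OF conn])
  moreover have "(X - {a} - U) \<union> (X - {b} - U) = X - U" using ab(3) by auto
  ultimately have "X - U \<in> \<C>" by simp
  moreover have "a \<in> X - U" "b \<in> X - U" "X - U \<subseteq> X - A" using AU UX ab by auto
  ultimately show ?thesis by (intro bexI[of _ "X - U"] conjI)
qed

lemma two_flimsy_complement_connected:
  assumes flimsy: "two_flimsy X \<C>" and A: "A \<in> \<C>"
  shows "X - A \<in> \<C>"
proof (cases "A = {}")
  case True
  have "X - {} \<in> \<C>"
    using flimsy[unfolded two_flimsy_def, THEN conjunct2, rule_format, of "{}"] by simp
  then show ?thesis using True by simp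
next
  case False
  show ?thesis
  proof (rule connected_if_pairs_joined)
    fix a b assume ab: "a \<in> X - A" "b \<in> X - A"
    show "\<exists>Z\<in>\<C>. a \<in> Z \<and> b \<in> Z \<and> Z \<subseteq> X - A"
    proof (cases "a = b")
      case True
      then show ?thesis using C1[of a] ab by blast
    next
      case neq: False
      have pt: "X - {x} \<in> \<C>" if "x \<in> X" for x
        using flimsy that unfolding two_flimsy_def by simp
      have "card {a, b} = 2" using neq by simp
      then have "X - {a, b} \<notin> \<C>"
        using flimsy ab unfolding two_flimsy_def by simp
      moreover have "A \<subseteq> X - {a, b}" using A connected_subset ab by auto
      ultimately show ?thesis
        using joined_outside_connected[OF pt pt _ A False] ab neq by simp
    qed
  qed
qed

lemma two_flimsy_T1:
  assumes "two_flimsy X \<C>"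
  shows "T1_connectivity X \<C>"
  unfolding T1_connectivity_def
proof (intro ballI impI notI)
  fix x y assume xy: "x \<in> X" "y \<in> X" "x \<noteq> y" "{x, y} \<in> \<C>"
  then have "card {x, y} = 2" by simp
  then have "X - {x, y} \<notin> \<C>" using assms xy unfolding two_flimsy_def by simp
  then show False using two_flimsy_complement_connected[OF assms xy(4)] by simp
qed

lemma two_flimsy_if_T1_complement:
  assumes size: "infinite X \<or> card X \<ge> 3" and T1: "T1_connectivity X \<C>"
    and compl: "\<And>A. A \<in> \<C> \<Longrightarrow> X - A \<in> \<C>"
  shows "two_flimsy X \<C>"
  unfolding two_flimsy_def
proof (intro conjI allI impI)
  show "infinite X \<or> card X > 2" using size by auto
next
  fix S assume S: "S \<subseteq> X" "finite S \<and> card S < 2"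
  then have "S = {} \<or> (\<exists>x. S = {x})"
    by (metis card_0_eq card_1_singletonE less_2_cases_iff One_nat_def)
  then have "S \<in> \<C>" using S(1) C1 empty_connected by auto
  then show "X - S \<in> \<C>" by (rule compl)
next
  fix S assume S: "S \<subseteq> X" "card S = 2"
  then obtain x y where xy: "S = {x, y}" "x \<noteq> y" by (auto simp: card_2_iff)
  then have "S \<notin> \<C>" using T1 S(1) unfolding T1_connectivity_def by simp
  moreover have "X - (X - S) = S" using S(1) by blast
  ultimately show "X - S \<notin> \<C>" using compl[of "X - S"] by auto
qed

end

theorem corollary3p9:
  fixes X :: "'a set" and \<C> :: "'a set set"
  assumes "connectivity_space X \<C>"
    and "infinite X \<or> card X \<ge> 3"
  shows "two_flimsy X \<C> \<longleftrightarrow>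
           T1_connectivity X \<C> \<and> (\<forall>A \<in> \<C>. X - A \<in> \<C>)"
proof -
  interpret connectivity_space X \<C> by fact
  show ?thesis
    using two_flimsy_T1 two_flimsy_complement_connected two_flimsy_if_T1_complement[OF assms(2)]
    by metis
qed

end
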